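(* For every integer $n\ge 3$, $$\big\lceil (\varphi+1)n -2\varphi\big\rceil\le \tilde{r}(C_3,P_n)\le 3n-4,$$ where $\varphi=(1+\sqrt5)/2$ is the golden ratio.
   Context: In the online size Ramsey game $\mathcal R(H_1,H_2)$, played on the edge set of the infinite complete graph $K_{\mathbb N}$, in each round Builder selects a previously unselected edge and Painter colours it red or blue; the game ends as soon as there is a red copy of $H_1$ or a blue copy of $H_2$. Builder tries to end the game as soon as possible, Painter tries to delay it, and $\tilde r(H_1,H_2)$ is the number of rounds under optimal play of both players. $C_3$ is the triangle and $P_n$ is the path on $n$ vertices. *)

theory Defs
  imports Complex_Main
begin

text \<open>Online size Ramsey game R(C_3, P_n) on the edge set of K_N (vertex set nat).
  A position is given by the set R of red edges and the set B of blue edges;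
  edges are two-element sets of naturals.\<close>

definition red_triangle :: "nat set set \<Rightarrow> bool" where
  "red_triangle R \<longleftrightarrow> (\<exists>a b c. a \<noteq> b \<and> b \<noteq> c \<and> a \<noteq> c \<and>
      {a, b} \<in> R \<and> {b, c} \<in> R \<and> {a, c} \<in> R)"

definition blue_path :: "nat \<Rightarrow> nat set set \<Rightarrow> bool" where
  "blue_path n B \<longleftrightarrow> (\<exists>vs :: nat list. length vs = n \<and> distinct vs \<and>
      (\<forall>i. i + 1 < n \<longrightarrow> {vs ! i, vs ! (i + 1)} \<in> B))"

definition game_over :: "nat \<Rightarrow> nat set set \<Rightarrow> nat set set \<Rightarrow> bool" where
  "game_over n R B \<longleftrightarrow> red_triangle R \<or> blue_path n B"

primrec builder_wins :: "nat \<Rightarrow> nat \<Rightarrow> nat set set \<Rightarrow> nat set set \<Rightarrow> bool" where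
  "builder_wins n 0 R B = game_over n R B"
| "builder_wins n (Suc k) R B = (game_over n R B \<or>
     (\<exists>u v. u \<noteq> v \<and> {u, v} \<notin> R \<and> {u, v} \<notin> B \<and>
        builder_wins n k (insert {u, v} R) B \<and>
        builder_wins n k R (insert {u, v} B)))"

definition online_ramsey_C3_P :: "nat \<Rightarrow> nat" where
  "online_ramsey_C3_P n = (LEAST k. builder_wins n k {} {})"

definition golden_ratio :: real where
  "golden_ratio = (1 + sqrt 5) / 2"

end

theory Submission
  imports Defs
begin

text \<open>
  Upper bound. Once Builder has a blue path on \<open>k\<close> vertices whose ends are joined by a red edge, a new
  vertex joined to both ends extends the path, and drawing one further edge restores this situation or
  gives a blue cycle with a red chord, which is as good. So every further vertex costs at most three
  rounds, and the last one at most two. To get there, Builder grows two disjoint blue paths whose first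
  vertices are joined by a red edge, by joining the last vertex \<open>y\<close> of one path to a new vertex \<open>v\<close>:
  a blue edge extends this path; otherwise the edge from \<open>v\<close> to the last vertex \<open>b\<close> of the other path
  extends the other path or forces the edge \<open>y b\<close> to be blue, which joins both paths into
  one with red-adjacent ends.

  Lower bound. Painter keeps every component two-sided, with red edges across and blue edges within
  the sides. An edge within a component is painted accordingly; for an edge joining two components both
  colours are possible, and Painter picks one that keeps a golden-ratio potential of the two sides in
  a region from which the blue path can never be completed too early.
\<close>

section \<open>The upper bound\<close>

lemma builder_wins_Suc: "builder_wins n k R B \<Longrightarrow> builder_wins n (Suc k) R B"
proof (induction k arbitrary: R B)
  case (Suc k)
  then show ?case
    using builder_wins.simps(2)[of n k] builder_wins.simps(2)[of n "Suc k"] by blast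
qed simp

lemma builder_wins_mono:
  assumes "builder_wins n k R B" "k \<le> m"
  shows "builder_wins n m R B"
  using assms(2,1)
  by (induction m rule: dec_induct) (auto intro: builder_wins_Suc simp del: builder_wins.simps)

lemma builder_wins_if_over: "game_over n R B \<Longrightarrow> builder_wins n k R B"
  by (cases k) auto

text \<open>If the edge is already drawn, one of the two resulting positions is the present one and
  the round is spare. So strategies need not check that edges are new.\<close>

lemma builder_move:
  assumes "u \<noteq> v" "builder_wins n k (insert {u, v} R) B" "builder_wins n k R (insert {u, v} B)"
  shows "builder_wins n (Suc k) R B"
proof (cases "{u, v} \<in> R \<or> {u, v} \<in> B")
  case True
  then show ?thesis
    using assms builder_wins_Suc by (metis insert_absorb)
next
  case False
  then show ?thesis
    using assms by auto
qed

text \<open>A red answer would close a triangle at the common red neighbour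
  \<open>w\<close>.\<close>

lemma builder_forced_move:
  assumes "u \<noteq> v" "u \<noteq> w" "v \<noteq> w" "{u, w} \<in> R" "{v, w} \<in> R"
    and "builder_wins n k R (insert {u, v} B)"
  shows "builder_wins n (Suc k) R B"
proof (rule builder_move[of u v])
  have "red_triangle (insert {u, v} R)"
    unfolding red_triangle_def using assms by blast
  then show "builder_wins n k (insert {u, v} R) B"
    by (intro builder_wins_if_over) (simp add: game_over_def)
qed (use assms in auto)

declare builder_wins.simps [simp del]

section \<open>Blue paths as vertex lists\<close>

definition bpath :: "nat set set \<Rightarrow> nat list \<Rightarrow> bool" where
  "bpath B vs \<longleftrightarrow> distinct vs \<and> successively (\<lambda>a b. {a, b} \<in> B) vs"

lemma bpath_insert: "bpath B vs \<Longrightarrow> bpath (insert e B) vs"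
  unfolding bpath_def by (auto elim: successively_mono)

lemma bpath_singleton [simp]: "bpath B [v]"
  by (simp add: bpath_def)

lemma bpath_rev [simp]: "bpath B (rev vs) \<longleftrightarrow> bpath B vs"
  by (simp add: bpath_def insert_commute)

lemma bpath_append:
  assumes "bpath B xs" "bpath B ys" "xs \<noteq> []" "ys \<noteq> []" "set xs \<inter> set ys = {}"
    and "{last xs, hd ys} \<in> B"
  shows "bpath B (xs @ ys)"
  using assms by (simp add: bpath_def successively_append_iff)

lemma bpath_Cons:
  assumes "bpath B ys" "ys \<noteq> []" "x \<notin> set ys" "{x, hd ys} \<in> B"
  shows "bpath B (x # ys)"
  using bpath_append[of B "[x]" ys] assms by simp

lemma bpath_snoc:
  assumes "bpath B xs" "xs \<noteq> []" "x \<notin> set xs" "{last xs, x} \<in> B"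
  shows "bpath B (xs @ [x])"
  using bpath_append[of B xs "[x]"] assms by simp

lemma bpath_rotate:
  assumes "bpath B (xs @ ys)" "{hd (xs @ ys), last (xs @ ys)} \<in> B"
  shows "bpath B (ys @ xs)"
  using assms by (auto simp: bpath_def successively_append_iff insert_commute)

lemma over_if_bpath:
  assumes "bpath B vs" "n \<le> length vs"
  shows "game_over n R B"
proof -
  have "blue_path n B"
    unfolding blue_path_def
    by (rule exI[of _ "take n vs"])
       (use assms in \<open>auto simp: bpath_def successively_conv_nth\<close>)
  then show ?thesis
    by (simp add: game_over_def)
qed

lemma builder_wins_if_bpath: "bpath B vs \<Longrightarrow> n \<le> length vs \<Longrightarrow> builder_wins n k R B"
  by (intro builder_wins_if_over over_if_bpath)

lemma fresh_vertex: "finite A \<Longrightarrow> \<exists>v :: nat. v \<notin> A"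
  using ex_new_if_finite infinite_UNIV_nat by blast

section \<open>Extending a path with red-adjacent ends\<close>

definition red_closed :: "nat set set \<Rightarrow> nat set set \<Rightarrow> nat list \<Rightarrow> bool" where
  "red_closed R B p \<longleftrightarrow> bpath B p \<and> p \<noteq> [] \<and> hd p \<noteq> last p \<and> {hd p, last p} \<in> R"

definition chorded_cycle :: "nat set set \<Rightarrow> nat set set \<Rightarrow> nat list \<Rightarrow> bool" where
  "chorded_cycle R B p \<longleftrightarrow> bpath B p \<and> {hd p, last p} \<in> B \<and>
     (\<exists>x\<in>set p. \<exists>y\<in>set p. x \<noteq> y \<and> {x, y} \<in> R)"

text \<open>A blue cycle can be cut open at any vertex, so a new vertex can be attached at either
  end of the chord.\<close>

lemma chorded_cycle_rotate:
  assumes "chorded_cycle R B p" "x \<in> set p"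
  obtains q where "chorded_cycle R B q" "hd q = x" "set q = set p" "length q = length p"
proof -
  obtain xs ys where p: "p = xs @ x # ys"
    using assms(2) by (metis split_list)
  define q where "q = (x # ys) @ xs"
  have b: "bpath B p" "{hd p, last p} \<in> B"
    using assms by (auto simp: chorded_cycle_def)
  have "bpath B q"
    unfolding q_def by (rule bpath_rotate) (use b p in auto)
  moreover have "{hd q, last q} \<in> B"
    using b unfolding p q_def
    by (cases xs rule: rev_cases)
       (auto simp: bpath_def successively_append_iff insert_commute)
  moreover have "set q = set p"
    by (auto simp: q_def p)
  ultimately have "chorded_cycle R B q"
    using assms(1) by (simp add: chorded_cycle_def)
  with that[of q] show ?thesis
    by (auto simp: q_def p)
qed

text \<open>Each missing vertex costs two rounds to attach and one to draw the edge between the new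
  ends. The last vertex does not need the third, whence the \<open>- 1\<close>.\<close>

lemma builder_extends:
  fixes n :: nat
  assumes "length p < n" "red_closed R B p \<or> chorded_cycle R B p"
  shows "builder_wins n (3 * (n - length p) - 1) R B"
  using assms
proof (induction "n - length p" arbitrary: R B p)
  case 0
  then show ?case by simp
next
  case (Suc m)
  define k where "k = length p"
  have n: "n = Suc (k + m)"
    using Suc.hyps(2) by (simp add: k_def)
  have IH: "builder_wins n (3 * m - 1) R' B'"
    if "length q = Suc k" "m > 0" "red_closed R' B' q \<or> chorded_cycle R' B' q" for R' B' q
    using Suc.hyps(1)[of q R' B'] that by (simp add: n)
  have finish: "builder_wins n j R' B'" if "bpath B' q" "length q = Suc k" "m = 0" for R' B' q j
    using that n by (auto intro: builder_wins_if_bpath)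
  obtain v where v: "v \<notin> set p"
    using fresh_vertex[of "set p"] by auto
  \<comment> \<open>The edge between the ends of the extended path helps in both colours: red makes
    the path \<open>red_closed\<close>, blue makes a cycle whose chord is already present.\<close>
  have close: "builder_wins n (3 * m) R' B'"
    if q: "bpath B' q" "length q = Suc k" "hd q \<noteq> last q"
      and chord: "x \<in> set q" "y \<in> set q" "x \<noteq> y" "{x, y} \<in> R'" for R' B' q x y
  proof (cases "m = 0")
    case True
    then show ?thesis using finish q by blast
  next
    case False
    have "q \<noteq> []" using q(2) by auto
    then have "red_closed (insert {hd q, last q} R') B' q"
      using q by (simp add: red_closed_def)
    moreover have "chorded_cycle R' (insert {hd q, last q} B') q"
      using q chord by (auto simp: chorded_cycle_def intro: bpath_insert)
    ultimately have "builder_wins n (Suc (3 * m - 1)) R' B'"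
      using False q by (intro builder_move[OF q(3)] IH[of q]) auto
    then show ?thesis using False by simp
  qed
  have "builder_wins n (3 * m + 2) R B"
    using Suc.prems(2)
  proof
    assume "red_closed R B p"
    then have p: "bpath B p" "p \<noteq> []" "hd p \<noteq> last p" "{hd p, last p} \<in> R"
      by (auto simp: red_closed_def)
    have h: "v \<noteq> hd p" "v \<noteq> last p"
      using v p by auto
    \<comment> \<open>In both colours \<open>p\<close> grows at one end, and the red edge between
      its old ends becomes the chord.\<close>
    have "builder_wins n (Suc (3 * m)) (insert {v, hd p} R) B"
    proof (rule builder_forced_move[of v "last p" "hd p"])
      let ?B = "insert {v, last p} B"
      have b: "bpath ?B (p @ [v])"
        using p v by (intro bpath_snoc bpath_insert) (auto simp: insert_commute)
      show "builder_wins n (3 * m) (insert {v, hd p} R) ?B"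
        by (rule close[OF b, of "hd p" "last p"]) (use p h in \<open>auto simp: k_def\<close>)
    qed (use h p in \<open>auto simp: insert_commute\<close>)
    moreover have "builder_wins n (Suc (3 * m)) R (insert {v, hd p} B)"
    proof (rule builder_wins_Suc)
      let ?B = "insert {v, hd p} B"
      have b: "bpath ?B (v # p)"
        using p v by (intro bpath_Cons bpath_insert) auto
      show "builder_wins n (3 * m) R ?B"
        by (rule close[OF b, of "hd p" "last p"]) (use p h in \<open>auto simp: k_def\<close>)
    qed
    ultimately have "builder_wins n (Suc (Suc (3 * m))) R B"
      by (rule builder_move[OF h(1)])
    then show ?thesis by simp
  next
    assume cyc: "chorded_cycle R B p"
    then obtain x y where xy: "x \<in> set p" "y \<in> set p" "x \<noteq> y" "{x, y} \<in> R"
      by (auto simp: chorded_cycle_def)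
    have attach: "builder_wins n (3 * m) R' (insert {v, z} B)"
      if "z \<in> set p" "R \<subseteq> R'" for z R'
    proof -
      obtain q where q: "chorded_cycle R B q" "hd q = z" "set q = set p" "length q = length p"
        using chorded_cycle_rotate[OF cyc \<open>z \<in> set p\<close>] .
      have ne: "q \<noteq> []" using q that by auto
      have "bpath (insert {v, z} B) (v # q)"
        using q v ne by (intro bpath_Cons bpath_insert) (auto simp: chorded_cycle_def)
      moreover have "last q \<noteq> v" using v ne q(3) by auto
      ultimately show ?thesis
        by (rule_tac close[of _ "v # q" x y]) (use q xy that ne in \<open>auto simp: k_def\<close>)
    qed
    have vx: "v \<noteq> x" "v \<noteq> y" using v xy by auto
    \<comment> \<open>A red answer makes \<open>x\<close> a common red neighbour of \<open>v\<close>
      and \<open>y\<close>, so \<open>v\<close> gets attached at \<open>y\<close> instead.\<close>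
    have "builder_wins n (Suc (3 * m)) (insert {v, x} R) B"
      by (rule builder_forced_move[of v y x])
         (use vx xy attach[of y "insert {v, x} R"] in \<open>auto simp: insert_commute\<close>)
    moreover have "builder_wins n (Suc (3 * m)) R (insert {v, x} B)"
      by (intro builder_wins_Suc attach xy subset_refl)
    ultimately have "builder_wins n (Suc (Suc (3 * m))) R B"
      by (rule builder_move[OF vx(1)])
    then show ?thesis by simp
  qed
  then show ?case by (simp add: n flip: k_def)
qed


text \<open>The disjunction at the end says that the edge between \<open>a\<close> and the first vertex of \<open>ts\<close>
  is blue or would close a red triangle when painted red. Builder draws it only when needed,
  which saves the one round by which the count would otherwise exceed \<open>3 * n - 4\<close>.\<close>

definition linked_paths ::
  "nat set set \<Rightarrow> nat set set \<Rightarrow> nat list \<Rightarrow> nat \<Rightarrow> nat list \<Rightarrow> bool" where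
  "linked_paths R B ys a ts \<longleftrightarrow> bpath B ys \<and> ys \<noteq> [] \<and> bpath B ts \<and> ts \<noteq> [] \<and> a \<notin> set ts \<and>
     set ys \<inter> set (a # ts) = {} \<and> {hd ys, a} \<in> R \<and>
     ({a, hd ts} \<in> B \<or> {hd ys, hd ts} \<in> R)"

text \<open>Either the edge is already blue and the round is spare, or \<open>hd ys\<close> is a
  common red neighbour of its ends and forces it.\<close>

lemma linked_paths_draw:
  assumes "linked_paths R B ys a ts" "builder_wins n k R (insert {a, hd ts} B)"
  shows "builder_wins n (Suc k) R B"
proof (cases "{a, hd ts} \<in> B")
  case True
  then show ?thesis
    using assms(2) by (auto simp: insert_absorb intro: builder_wins_Suc)
next
  case False
  have "hd ys \<in> set ys" "hd ts \<in> set ts"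
    using assms(1) by (auto simp: linked_paths_def)
  then have "hd ys \<noteq> hd ts" "hd ys \<noteq> a" "hd ts \<noteq> a"
    using assms(1) unfolding linked_paths_def by (force, force, metis)
  then show ?thesis
    using assms False
    by (intro builder_forced_move[of a "hd ts" "hd ys"]) (auto simp: linked_paths_def insert_commute)
qed

text \<open>A new vertex costs one round on \<open>ys\<close> but two on \<open>ts\<close>, which is
  tried only after a red answer at \<open>ys\<close>; hence the weights 1 and 2. After two red
  answers the paths are joined, and \<open>builder_extends\<close> finishes if vertices are still
  missing.\<close>

lemma builder_linked_paths:
  fixes n :: nat
  assumes "linked_paths R B ys a ts" "length ys < n" "Suc (length ts) < n"
  shows "builder_wins n (3 * n - 3 - length ys - 2 * length ts) R B"
  using assms
proof (induction "2 * n - length ys - length ts" arbitrary: R B ys ts rule: less_induct)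
  case less
  define s q where "s = length ys" and "q = length ts"
  have L: "bpath B ys" "ys \<noteq> []" "bpath B ts" "ts \<noteq> []" "a \<notin> set ts"
    "set ys \<inter> set ts = {}" "a \<notin> set ys" "{hd ys, a} \<in> R" "{a, hd ts} \<in> B \<or> {hd ys, hd ts} \<in> R"
    using less.prems(1) by (auto simp: linked_paths_def)
  have sq: "s \<ge> 1" "q \<ge> 1" "s < n" "Suc q < n"
    using less.prems L by (auto simp: s_def q_def Suc_le_eq)
  have mem: "hd ys \<in> set ys" "last ys \<in> set ys" "hd ts \<in> set ts" "last ts \<in> set ts"
    using L by auto
  then have "last ys \<noteq> last ts" "hd ys \<noteq> hd ts"
    using L(6) by auto
  note mem = mem this
  obtain v where v: "v \<notin> set ys \<union> set ts \<union> {a}"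
    using fresh_vertex[of "set ys \<union> set ts \<union> {a}"] by auto
  show ?case
  proof (cases "Suc s = n \<and> q + 2 = n")
    \<comment> \<open>Only two rounds are left, too few for the general step. The edge from
      \<open>a\<close> to a new vertex, if red, forces a blue edge completing \<open>ys\<close>; if
      blue, the edge from \<open>a\<close> to \<open>hd ts\<close> completes the other path.\<close>
    case True
    have va: "a \<noteq> v" using v by auto
    have "builder_wins n 1 (insert {a, v} R) B"
      unfolding One_nat_def
    proof (rule builder_forced_move[of v "hd ys" a])
      have "bpath (insert {v, hd ys} B) (v # ys)"
        using L v by (intro bpath_Cons bpath_insert) auto
      then show "builder_wins n 0 (insert {a, v} R) (insert {v, hd ys} B)"
        using True by (intro builder_wins_if_bpath) (auto simp: s_def)
    qed (use v mem L in \<open>auto simp: insert_commute\<close>)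
    moreover have "builder_wins n 1 R (insert {a, v} B)"
      unfolding One_nat_def
    proof (rule linked_paths_draw)
      show "linked_paths R (insert {a, v} B) ys a ts"
        using less.prems(1) by (auto simp: linked_paths_def intro: bpath_insert)
      have "bpath (insert {a, hd ts} (insert {a, v} B)) (v # a # ts)"
        using L v by (intro bpath_Cons bpath_insert) (auto simp: insert_commute)
      then show "builder_wins n 0 R (insert {a, hd ts} (insert {a, v} B))"
        using True by (intro builder_wins_if_bpath) (auto simp: q_def)
    qed
    ultimately have "builder_wins n (Suc 1) R B"
      by (rule builder_move[OF va])
    then show ?thesis
      by (rule builder_wins_mono) (use True in \<open>auto simp: s_def q_def\<close>)
  next
    case False
    \<comment> \<open>The budget left after three rounds; outside the case above the subtraction is
      not truncated.\<close>
    define m where "m = 3 * n - 6 - s - 2 * q"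
    have m: "3 * n = m + 6 + s + 2 * q"
      using False sq by (auto simp: m_def)
    let ?R1 = "insert {last ys, v} R" and ?R2 = "insert {v, last ts} (insert {last ys, v} R)"
    let ?B2 = "insert {last ys, last ts} B"
    have "builder_wins n (Suc (Suc m)) R (insert {last ys, v} B)"
    proof -
      let ?B = "insert {last ys, v} B"
      have b: "bpath ?B (ys @ [v])"
        using L v by (intro bpath_snoc bpath_insert) auto
      show ?thesis
      proof (cases "Suc s = n")
        case True
        then show ?thesis
          using b by (intro builder_wins_if_bpath) (auto simp: s_def)
      next
        case False
        have "linked_paths R ?B (ys @ [v]) a ts"
          using L v b by (auto simp: linked_paths_def intro: bpath_insert)
        then have "builder_wins n (3 * n - 3 - length (ys @ [v]) - 2 * length ts) R ?B"
          using False sq by (intro less.hyps) (auto simp: s_def q_def)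
        then show ?thesis
          by (rule builder_wins_mono) (use m in \<open>auto simp: s_def q_def\<close>)
      qed
    qed
    moreover have "builder_wins n (Suc (Suc m)) ?R1 B"
    proof (rule builder_move[of v "last ts"])
      show "v \<noteq> last ts" using v mem by auto
      let ?B = "insert {v, last ts} B"
      have b: "bpath ?B (ts @ [v])"
        using L v by (intro bpath_snoc bpath_insert) (auto simp: insert_commute)
      then have b': "bpath (insert {a, hd (ts @ [v])} ?B) (a # ts @ [v])"
        using L v by (intro bpath_Cons bpath_insert[of ?B]) auto
      have lp: "linked_paths ?R1 ?B ys a (ts @ [v])"
        using L v b by (auto simp: linked_paths_def intro: bpath_insert)
      show "builder_wins n (Suc m) ?R1 ?B"
      proof (cases "q + 2 = n")
        case True
        show ?thesis
          using True b'
          by (intro linked_paths_draw[OF lp] builder_wins_if_bpath) (auto simp: q_def)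
      next
        case False
        have "builder_wins n (3 * n - 3 - length ys - 2 * length (ts @ [v])) ?R1 ?B"
          using lp False sq by (intro less.hyps) (auto simp: s_def q_def)
        then show ?thesis
          by (rule builder_wins_mono) (use m in \<open>auto simp: s_def q_def\<close>)
      qed
      show "builder_wins n (Suc m) ?R2 B"
      proof (rule builder_forced_move[of "last ys" "last ts" v])
        show "builder_wins n m ?R2 ?B2"
        proof (cases "s + q < n")
          case False
          have "bpath ?B2 (ys @ rev ts)"
            using L by (intro bpath_append) (auto simp: hd_rev intro: bpath_insert)
          then show ?thesis
            using False by (intro builder_wins_if_bpath) (auto simp: s_def q_def)
        next
          case True
          \<comment> \<open>The joined path has \<open>s + q + 1\<close> vertices, and its ends
            \<open>hd ys\<close> and \<open>a\<close> are red-adjacent.\<close>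
          have closed: "builder_wins n k ?R2 B'"
            if B': "insert {a, hd ts} ?B2 \<subseteq> B'" and k: "3 * n - 3 * s - 3 * q - 4 \<le> k" for B' k
          proof -
            let ?p = "ys @ rev (a # ts)"
            have mono: "bpath B' xs" if "bpath B xs" for xs
              using that B' unfolding bpath_def by (auto elim!: successively_mono)
            have "bpath B' (rev (a # ts))"
              unfolding bpath_rev using L B' mono by (intro bpath_Cons) auto
            then have p: "bpath B' ?p"
              using L B' mono by (intro bpath_append) (auto simp: hd_append hd_rev simp del: bpath_rev)
            have rc: "red_closed ?R2 B' ?p"
              using p L mem by (auto simp: red_closed_def)
            show ?thesis
            proof (cases "s + q + 1 = n")
              case True
              then show ?thesis
                using p by (intro builder_wins_if_bpath) (auto simp: s_def q_def)
            next
              case False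
              have "builder_wins n (3 * (n - length ?p) - 1) ?R2 B'"
                using rc False True by (intro builder_extends) (auto simp: s_def q_def)
              then show ?thesis
                by (rule builder_wins_mono) (use k in \<open>auto simp: s_def q_def\<close>)
            qed
          qed
          show ?thesis
          proof (cases "{a, hd ts} \<in> B")
            case True
            then show ?thesis
              using m sq by (intro closed) auto
          next
            case nb: False
            then have red: "{hd ys, hd ts} \<in> R" using L by auto
            show ?thesis
            proof (cases m)
              \<comment> \<open>No round remains for the edge at \<open>a\<close>, but then both
                paths are single vertices and the red edge between them forms a triangle with
                \<open>v\<close>.\<close>
              case 0
              then have "s = 1" "q = 1"
                using m sq \<open>s + q < n\<close> by auto
              then have "{last ys, last ts} \<in> R"
                using red by (auto simp: s_def q_def length_Suc_conv)
              then have "red_triangle ?R2"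
                unfolding red_triangle_def
                by (intro exI[of _ "last ys"] exI[of _ v] exI[of _ "last ts"])
                   (use mem v L in auto)
              then show ?thesis
                by (intro builder_wins_if_over) (simp add: game_over_def)
            next
              case (Suc m')
              have "builder_wins n m' ?R2 (insert {a, hd ts} ?B2)"
                using Suc m sq by (intro closed) auto
              moreover have "a \<noteq> hd ts" "a \<noteq> hd ys"
                using mem L by auto
              moreover have "{a, hd ys} \<in> ?R2" "{hd ts, hd ys} \<in> ?R2"
                using L(8) red by (auto simp: insert_commute)
              ultimately have "builder_wins n (Suc m') ?R2 ?B2"
                using mem by (intro builder_forced_move[of a "hd ts" "hd ys"]) auto
              then show ?thesis using Suc by simp
            qed
          qed
        qed
      qed (use v mem L in \<open>auto simp: insert_commute\<close>)
    qed
    ultimately have "builder_wins n (Suc (Suc (Suc m))) R B"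
      using v mem by (intro builder_move[of "last ys" v n "Suc (Suc m)"]) auto
    then show ?thesis
      by (rule builder_wins_mono) (use m in \<open>auto simp: s_def q_def\<close>)
  qed
qed

text \<open>Builder extends one blue path until the first red answer. The red edge then links the
  new vertex to the last vertex of the path, and the rest of the path becomes
  \<open>ts\<close>.\<close>

lemma builder_from_blue_path:
  fixes n :: nat
  assumes "n \<ge> 3" "bpath B p" "p \<noteq> []" "length p < n"
  shows "builder_wins n (3 * n - 3 - length p) R B"
  using assms(2-)
proof (induction "n - length p" arbitrary: B p)
  case 0
  then show ?case by simp
next
  case (Suc k)
  obtain v where v: "v \<notin> set p"
    using fresh_vertex[of "set p"] by auto
  have lv: "last p \<noteq> v" using v Suc.prems by auto
  define m where "m = 3 * n - 4 - length p"
  have m: "3 * n = m + 4 + length p"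
    using Suc.prems assms(1) by (simp add: m_def)
  have "builder_wins n m R (insert {last p, v} B)"
  proof -
    let ?B = "insert {last p, v} B"
    have b: "bpath ?B (p @ [v])"
      using Suc.prems v by (intro bpath_snoc bpath_insert) auto
    show ?thesis
    proof (cases "Suc (length p) = n")
      case True
      then show ?thesis
        using b by (intro builder_wins_if_bpath) auto
    next
      case False
      have "builder_wins n (3 * n - 3 - length (p @ [v])) R ?B"
        using Suc.prems Suc.hyps(2) False b by (intro Suc.hyps(1)) auto
      then show ?thesis
        by (rule builder_wins_mono) (use m in auto)
    qed
  qed
  moreover have "builder_wins n m (insert {last p, v} R) B"
  proof (cases "length p = 1")
    \<comment> \<open>There is no rest to serve as \<open>ts\<close>, so one more edge at
      \<open>y\<close> is drawn. If it is red too, \<open>y\<close> is a common red neighbour of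
      \<open>v\<close> and \<open>w\<close>, as in the second alternative of
      \<open>linked_paths\<close>.\<close>
    case True
    then obtain y where p: "p = [y]"
      by (auto simp: length_Suc_conv)
    let ?R = "insert {y, v} R"
    obtain w where w: "w \<notin> {v, y}"
      using fresh_vertex[of "{v, y}"] by auto
    have yv: "y \<noteq> v" "y \<noteq> w" using v w p by auto
    obtain m' where m': "m = Suc m'"
      using m True assms(1) by (cases m) auto
    have "linked_paths ?R (insert {y, w} B) [v] y [w]"
      using yv w by (auto simp: linked_paths_def insert_commute)
    then have "builder_wins n m' ?R (insert {y, w} B)"
      using builder_linked_paths[of ?R "insert {y, w} B" "[v]" y "[w]" n] assms(1) m m' True
      by (auto elim!: builder_wins_mono)
    moreover have "linked_paths (insert {y, w} ?R) B [y] v [w]"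
      using yv w by (auto simp: linked_paths_def insert_commute)
    then have "builder_wins n m' (insert {y, w} ?R) B"
      using builder_linked_paths[of "insert {y, w} ?R" B "[y]" v "[w]" n] assms(1) m m' True
      by (auto elim!: builder_wins_mono)
    ultimately show ?thesis
      unfolding m' p using builder_move[OF yv(2)] by auto
  next
    case False
    obtain a b xs where p: "rev p = a # b # xs"
      using False Suc.prems(2) by (cases "rev p" rule: list.exhaust; cases "tl (rev p)") auto
    have bp: "bpath B (a # b # xs)"
      using Suc.prems(1) p by (metis bpath_rev)
    have len: "length p = length xs + 2"
      using p by (metis length_rev length_Cons add_2_eq_Suc')
    have "last p = a" "set p = set (a # b # xs)"
      using p by (metis hd_rev list.sel(1)) (metis p set_rev)
    then have "linked_paths (insert {last p, v} R) B [v] a (b # xs)"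
      using bp v by (auto simp: linked_paths_def bpath_def insert_commute)
    then have "builder_wins n (3 * n - 3 - length [v] - 2 * length (b # xs)) (insert {last p, v} R) B"
      using Suc.prems(3) len by (intro builder_linked_paths) auto
    then show ?thesis
      by (rule builder_wins_mono) (use m len in auto)
  qed
  ultimately have "builder_wins n (Suc m) R B"
    using builder_move[OF lv] by blast
  then show ?case
    by (rule builder_wins_mono) (use m in auto)
qed

lemma builder_wins_start: "n \<ge> 3 \<Longrightarrow> builder_wins n (3 * n - 4) {} {}"
  using builder_from_blue_path[of n "{}" "[0]" "{}"] by simp


section \<open>The lower bound\<close>

abbreviation (input) "\<phi> \<equiv> golden_ratio"

lemma golden_ratio_square: "\<phi> * \<phi> = \<phi> + 1"
  by (simp add: golden_ratio_def field_simps)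

lemma golden_ratio_gt_1: "\<phi> > 1"
  by (simp add: golden_ratio_def)

lemma golden_ratio_less_2: "\<phi> < 2"
proof -
  have "sqrt 5 < 3"
    by (rule real_less_lsqrt) auto
  then show ?thesis
    by (simp add: golden_ratio_def)
qed

text \<open>The arguments are the scores, defined below, of the two sides of a component. The slopes are
  those of the moves available to Painter when Builder attaches a new vertex: painting red changes
  the two scores by \<open>(1, - 1 / \<phi>)\<close>, painting blue by \<open>(- \<phi>, 1)\<close>, and both preserve
  \<open>x + \<phi> * y\<close>. The constant is \<open>\<phi> ^ 3 = 2 * \<phi> + 1\<close>. The second alternative in \<open>fine\<close> covers
  isolated vertices.\<close>

definition safe :: "real \<Rightarrow> real \<Rightarrow> bool" where
  "safe x y \<longleftrightarrow> 0 \<le> x \<and> 0 \<le> y \<and> 2 * \<phi> + 1 \<le> x + \<phi> * y \<and> 2 * \<phi> + 1 \<le> y + \<phi> * x"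

definition fine :: "real \<Rightarrow> real \<Rightarrow> bool" where
  "fine x y \<longleftrightarrow> safe x y \<or> \<phi> - 1 \<le> x \<and> 2 * \<phi> - 1 \<le> y"

lemma safe_commute: "safe x y \<longleftrightarrow> safe y x"
  by (auto simp: safe_def)

lemma safe_mono: "safe x y \<Longrightarrow> x \<le> x' \<Longrightarrow> y \<le> y' \<Longrightarrow> safe x' y'"
  unfolding safe_def
  using golden_ratio_gt_1 mult_left_mono[of x x' \<phi>] mult_left_mono[of y y' \<phi>] by linarith

lemma fine_mono: "fine x y \<Longrightarrow> x \<le> x' \<Longrightarrow> y \<le> y' \<Longrightarrow> fine x' y'"
  unfolding fine_def using safe_mono by force

lemma fine_nonneg: "fine x y \<Longrightarrow> 0 \<le> x"
  unfolding fine_def safe_def using golden_ratio_gt_1 by linarith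

lemma mult_golden_ratio: "x \<le> y \<Longrightarrow> \<phi> * x \<le> \<phi> * y"
  using golden_ratio_gt_1 by (simp add: mult_left_mono)

lemma mult_golden_ratio2: "\<phi> * (\<phi> * x) = \<phi> * x + x"
proof -
  have "\<phi> * (\<phi> * x) = (\<phi> * \<phi>) * x" by (simp only: mult.assoc)
  also have "\<dots> = (\<phi> + 1) * x" by (simp only: golden_ratio_square)
  finally show ?thesis by (simp add: distrib_right)
qed

lemma golden_ratio_double: "\<phi> * (2 * \<phi>) = 2 * \<phi> + 2"
  using golden_ratio_square by simp

lemmas golden_simps = golden_ratio_square golden_ratio_double mult_golden_ratio2 distrib_left right_diff_distrib

section \<open>Choosing a colour when two components merge\<close>

text \<open>Small \<alpha> and \<delta> force \<beta> and \<gamma> to be large, by the linear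
  constraints in \<open>safe\<close>; this pays for the blue option.\<close>

lemma painter_option_safe_aux:
  assumes "safe \<alpha> \<beta>" "safe \<gamma> \<delta>" "\<alpha> + \<delta> < 2 * \<phi> - 2"
  shows "safe (\<alpha> + \<gamma> + 1 - 2 * \<phi>) (\<beta> + \<delta> + 2 - 2 * \<phi>)"
proof -
  note * = assms(1,2)[unfolded safe_def] assms(3)
  have "\<phi> * (2 * \<phi> + 1) \<le> \<phi> * (\<gamma> + \<phi> * \<delta>)" "\<phi> * (2 * \<phi> + 1) \<le> \<phi> * (\<beta> + \<phi> * \<alpha>)"
    "\<phi> * (\<alpha> + \<delta>) \<le> \<phi> * (2 * \<phi> - 2)" "\<phi> * 0 \<le> \<phi> * \<alpha>" "\<phi> * 0 \<le> \<phi> * \<delta>"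
    by (intro mult_golden_ratio; use * in auto)+
  then have "\<phi> * \<gamma> + \<phi> * \<delta> + \<delta> \<ge> 3 * \<phi> + 2" "\<phi> * \<beta> + \<phi> * \<alpha> + \<alpha> \<ge> 3 * \<phi> + 2"
    "\<phi> * \<alpha> + \<phi> * \<delta> \<le> 2" "0 \<le> \<phi> * \<alpha>" "0 \<le> \<phi> * \<delta>"
    by (simp_all add: golden_simps)
  with * show ?thesis
    unfolding safe_def golden_simps using golden_ratio_less_2 golden_ratio_gt_1
    by (intro conjI) linarith+
qed

text \<open>The red option costs \<open>2 * \<phi>\<close> in each linear constraint, less than the
  second component contributes. So it fails only through a negative score, and then the blue option
  works.\<close>

lemma painter_option_safe:
  assumes "safe \<alpha> \<beta>" "safe \<gamma> \<delta>"
  shows "safe (\<alpha> + \<delta> + 2 - 2 * \<phi>) (\<beta> + \<gamma> + 2 - 2 * \<phi>) \<or>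
         safe (\<alpha> + \<gamma> + 1 - 2 * \<phi>) (\<beta> + \<delta> + 2 - 2 * \<phi>)"
proof (cases "\<alpha> + \<delta> < 2 * \<phi> - 2 \<or> \<gamma> + \<beta> < 2 * \<phi> - 2")
  case True
  then show ?thesis
    using painter_option_safe_aux[of \<alpha> \<beta> \<gamma> \<delta>] painter_option_safe_aux[of \<gamma> \<delta> \<alpha> \<beta>] assms
    by (auto simp: add.commute)
next
  case False
  then have "safe (\<alpha> + \<delta> + 2 - 2 * \<phi>) (\<beta> + \<gamma> + 2 - 2 * \<phi>)"
    using assms unfolding safe_def using golden_ratio_gt_1
    by (auto simp: golden_simps)
  then show ?thesis ..
qed

text \<open>The bounds on \<gamma> and \<delta> are the scores of an isolated vertex. Red is
  affordable unless \<beta> is below \<open>\<phi> - 1\<close>, and then \<alpha> is large enough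
  for blue.\<close>

lemma painter_option_leaf:
  assumes "safe \<alpha> \<beta>" "\<phi> - 1 \<le> \<gamma>" "2 * \<phi> - 1 \<le> \<delta>"
  shows "safe (\<alpha> + \<delta> + 2 - 2 * \<phi>) (\<beta> + \<gamma> + 2 - 2 * \<phi>) \<or>
         safe (\<alpha> + \<gamma> + 1 - 2 * \<phi>) (\<beta> + \<delta> + 2 - 2 * \<phi>)"
proof (cases "\<beta> < \<phi> - 1")
  case True
  note * = assms(1)[unfolded safe_def]
  have "\<phi> * \<beta> \<le> \<phi> * (\<phi> - 1)" "\<phi> * (2 * \<phi> + 1) \<le> \<phi> * (\<alpha> + \<phi> * \<beta>)"
    by (intro mult_golden_ratio; use * True in auto)+
  then have "\<phi> * \<beta> \<le> 1" "\<phi> * \<alpha> + \<phi> * \<beta> + \<beta> \<ge> 3 * \<phi> + 2"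
    by (simp_all add: golden_simps)
  with * have "safe (\<alpha> - \<phi>) (\<beta> + 1)"
    unfolding safe_def using golden_ratio_gt_1 golden_ratio_less_2 True
    by (auto simp: golden_simps)
  then have "safe (\<alpha> + \<gamma> + 1 - 2 * \<phi>) (\<beta> + \<delta> + 2 - 2 * \<phi>)"
    by (rule safe_mono) (use assms in auto)
  then show ?thesis ..
next
  case False
  with assms(1) have "safe (\<alpha> + 1) (\<beta> + 1 - \<phi>)"
    unfolding safe_def using golden_ratio_gt_1 by (auto simp: golden_simps)
  then have "safe (\<alpha> + \<delta> + 2 - 2 * \<phi>) (\<beta> + \<gamma> + 2 - 2 * \<phi>)"
    by (rule safe_mono) (use assms in auto)
  then show ?thesis ..
qed

text \<open>Each pair holds the scores of the two sides of a component, first the side with the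
  endpoint of the new edge. The first alternative is for a red edge, the second for a blue
  one.\<close>

lemma painter_option:
  assumes "fine \<alpha> \<beta>" "fine \<gamma> \<delta>"
  shows "safe (\<alpha> + \<delta> + 2 - 2 * \<phi>) (\<beta> + \<gamma> + 2 - 2 * \<phi>) \<or>
         safe (\<alpha> + \<gamma> + 1 - 2 * \<phi>) (\<beta> + \<delta> + 2 - 2 * \<phi>)"
proof -
  consider "safe \<alpha> \<beta>" "safe \<gamma> \<delta>"
    | "safe \<alpha> \<beta>" "\<phi> - 1 \<le> \<gamma>" "2 * \<phi> - 1 \<le> \<delta>"
    | "safe \<gamma> \<delta>" "\<phi> - 1 \<le> \<alpha>" "2 * \<phi> - 1 \<le> \<beta>"
    | "\<phi> - 1 \<le> \<alpha>" "2 * \<phi> - 1 \<le> \<beta>" "\<phi> - 1 \<le> \<gamma>" "2 * \<phi> - 1 \<le> \<delta>"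
    using assms unfolding fine_def by blast
  then show ?thesis
  proof cases
    case 1
    then show ?thesis by (rule painter_option_safe)
  next
    case 2
    then show ?thesis by (rule painter_option_leaf)
  next
    case 3
    then show ?thesis
      using painter_option_leaf[of \<gamma> \<delta> \<alpha> \<beta>] safe_commute by (auto simp: add.commute)
  next
    case 4
    \<comment> \<open>The scores of a single red edge, on the boundary of the region.\<close>
    have "safe \<phi> \<phi>"
      using golden_ratio_gt_1 by (auto simp: safe_def golden_simps)
    then have "safe (\<alpha> + \<delta> + 2 - 2 * \<phi>) (\<beta> + \<gamma> + 2 - 2 * \<phi>)"
      by (rule safe_mono) (use 4 in auto)
    then show ?thesis ..
  qed
qed

section \<open>Edge counts and the score of a side\<close>

definition inside :: "'a set set \<Rightarrow> 'a set \<Rightarrow> nat" where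
  "inside E X = card {e \<in> E. e \<subseteq> X}"

text \<open>If \<open>S\<close> and \<open>T\<close> are the sides of a component, then a blue path spanning \<open>S\<close> costs
  \<open>card S - 1\<close> blue edges in \<open>S\<close> on top of the edges counted here; the score measures by how much
  the latter exceed \<open>\<phi> * (card S - 2) + 1\<close>.\<close>

definition score :: "'a set set \<Rightarrow> 'a set set \<Rightarrow> 'a set \<Rightarrow> 'a set \<Rightarrow> real" where
  "score R B S T = real (inside R (S \<union> T)) + real (inside B T) - \<phi> * (real (card S) - 2) - 1"

lemma inside_mono: "finite E' \<Longrightarrow> E \<subseteq> E' \<Longrightarrow> inside E X \<le> inside E' X"
  unfolding inside_def by (intro card_mono) auto

lemma inside_insert:
  assumes "finite E" "e \<notin> E" "e \<subseteq> X"
  shows "inside (insert e E) X = inside E X + 1"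
proof -
  have "{e' \<in> insert e E. e' \<subseteq> X} = insert e {e' \<in> E. e' \<subseteq> X}"
    using assms by auto
  then show ?thesis
    using assms by (simp add: inside_def)
qed

lemma inside_Un:
  assumes "finite E" "{} \<notin> E" "X \<inter> Y = {}"
  shows "inside E X + inside E Y \<le> inside E (X \<union> Y)"
proof -
  have "{e \<in> E. e \<subseteq> X} \<inter> {e \<in> E. e \<subseteq> Y} = {}"
  proof safe
    fix e assume "e \<in> E" "e \<subseteq> X" "e \<subseteq> Y"
    then have "e = {}" using assms(3) by blast
    with \<open>e \<in> E\<close> assms(2) show "e \<in> {}" by simp
  qed
  then have "inside E X + inside E Y = card ({e \<in> E. e \<subseteq> X} \<union> {e \<in> E. e \<subseteq> Y})"
    unfolding inside_def using assms(1) by (intro card_Un_disjoint[symmetric]) auto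
  also have "\<dots> \<le> inside E (X \<union> Y)"
    unfolding inside_def using assms(1) by (intro card_mono) auto
  finally show ?thesis .
qed

lemma score_mono:
  assumes "finite R'" "finite B'" "R \<subseteq> R'" "B \<subseteq> B'"
  shows "score R B S T \<le> score R' B' S T"
  unfolding score_def using inside_mono[OF assms(1,3), of "S \<union> T"] inside_mono[OF assms(2,4), of T]
  by auto

text \<open>Edge counts add up, but the constant \<open>2 * \<phi> - 1\<close> of the score is
  present once instead of twice.\<close>

lemma score_Un:
  assumes "finite R" "finite B" "{} \<notin> R" "{} \<notin> B" "(S \<union> T) \<inter> (P \<union> Q) = {}"
  shows "score R B S T + score R B P Q + 1 - 2 * \<phi> \<le> score R B (S \<union> P) (T \<union> Q)"
proof -
  have "inside R (S \<union> T) + inside R (P \<union> Q) \<le> inside R ((S \<union> P) \<union> (T \<union> Q))"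
    using inside_Un[OF assms(1,3,5)] by (simp add: Un_ac)
  moreover have "inside B T + inside B Q \<le> inside B (T \<union> Q)"
    using assms by (intro inside_Un) auto
  moreover have "\<phi> * real (card (S \<union> P)) \<le> \<phi> * (real (card S) + real (card P))"
    using card_Un_le[of S P] golden_ratio_gt_1 by (intro mult_left_mono) auto
  ultimately show ?thesis
    unfolding score_def by (simp add: algebra_simps)
qed

section \<open>Painter's invariant\<close>

definition cls :: "('a \<Rightarrow> 'c) \<Rightarrow> ('a \<Rightarrow> bool) \<Rightarrow> 'c \<Rightarrow> bool \<Rightarrow> 'a set" where
  "cls C \<sigma> c \<tau> = {w. C w = c \<and> \<sigma> w = \<tau>}"

text \<open>\<open>C\<close> maps a vertex to its component and \<open>\<sigma>\<close> to its side there. Red edges join different sides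
  of a component, blue edges stay within a side.\<close>

definition painter_inv ::
  "nat set set \<Rightarrow> nat set set \<Rightarrow> (nat \<Rightarrow> nat) \<Rightarrow> (nat \<Rightarrow> bool) \<Rightarrow> bool" where
  "painter_inv R B C \<sigma> \<longleftrightarrow> finite R \<and> finite B \<and> {} \<notin> R \<and> {} \<notin> B \<and>
     (\<forall>u v. {u, v} \<in> R \<longrightarrow> C u = C v \<and> \<sigma> u \<noteq> \<sigma> v) \<and>
     (\<forall>u v. {u, v} \<in> B \<longrightarrow> C u = C v \<and> \<sigma> u = \<sigma> v) \<and>
     (\<forall>c \<tau>. finite (cls C \<sigma> c \<tau>)) \<and>
     (\<forall>w. fine (score R B (cls C \<sigma> (C w) (\<sigma> w)) (cls C \<sigma> (C w) (\<not> \<sigma> w)))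
              (score R B (cls C \<sigma> (C w) (\<not> \<sigma> w)) (cls C \<sigma> (C w) (\<sigma> w))))"

lemma painter_invD:
  assumes "painter_inv R B C \<sigma>"
  shows "finite R" "finite B" "{} \<notin> R" "{} \<notin> B"
    "\<And>u v. {u, v} \<in> R \<Longrightarrow> C u = C v \<and> \<sigma> u \<noteq> \<sigma> v"
    "\<And>u v. {u, v} \<in> B \<Longrightarrow> C u = C v \<and> \<sigma> u = \<sigma> v"
    "\<And>c \<tau>. finite (cls C \<sigma> c \<tau>)"
    "\<And>w. fine (score R B (cls C \<sigma> (C w) (\<sigma> w)) (cls C \<sigma> (C w) (\<not> \<sigma> w)))
              (score R B (cls C \<sigma> (C w) (\<not> \<sigma> w)) (cls C \<sigma> (C w) (\<sigma> w)))"
  using assms unfolding painter_inv_def by blast+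

text \<open>Every vertex is a component with an empty opposite side, meeting the second alternative
  of \<open>fine\<close> with equality.\<close>

lemma painter_inv_start: "painter_inv {} {} id (\<lambda>_. True)"
proof -
  have cls: "cls id (\<lambda>_. True) w \<tau> = (if \<tau> then {w} else {})" for w :: nat and \<tau>
    by (auto simp: cls_def)
  show ?thesis
    by (auto simp: painter_inv_def score_def inside_def fine_def cls)
qed

text \<open>An edge within a component keeps the classes and can only raise scores.\<close>

lemma painter_inv_insert:
  assumes inv: "painter_inv R B C \<sigma>" and "C u = C v"
  shows "\<sigma> u \<noteq> \<sigma> v \<Longrightarrow> painter_inv (insert {u, v} R) B C \<sigma>"
    and "\<sigma> u = \<sigma> v \<Longrightarrow> painter_inv R (insert {u, v} B) C \<sigma>"
proof -
  note I = painter_invD[OF inv]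
  have f: "fine (score R' B' (cls C \<sigma> (C w) (\<sigma> w)) (cls C \<sigma> (C w) (\<not> \<sigma> w)))
              (score R' B' (cls C \<sigma> (C w) (\<not> \<sigma> w)) (cls C \<sigma> (C w) (\<sigma> w)))"
    if "finite R'" "finite B'" "R \<subseteq> R'" "B \<subseteq> B'" for R' B' w
    by (rule fine_mono[OF I(8)[of w]]) (intro score_mono that)+
  show "painter_inv (insert {u, v} R) B C \<sigma>" if "\<sigma> u \<noteq> \<sigma> v"
    unfolding painter_inv_def
    using I(1-7) assms(2) that f[of "insert {u, v} R" B, OF _ _ subset_insertI subset_refl]
    by (auto simp: doubleton_eq_iff)
  show "painter_inv R (insert {u, v} B) C \<sigma>" if "\<sigma> u = \<sigma> v"
    unfolding painter_inv_def
    using I(1-7) assms(2) that f[of R "insert {u, v} B", OF _ _ subset_refl subset_insertI]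
    by (auto simp: doubleton_eq_iff)
qed

text \<open>The flag \<open>f\<close> says whether the sides of the component of \<open>v\<close> are swapped in the union.\<close>

lemma painter_inv_merge:
  fixes C :: "nat \<Rightarrow> nat"
  assumes inv: "painter_inv R B C \<sigma>" and uv: "C u \<noteq> C v"
    and ext: "R' = insert {u, v} R \<and> B' = B \<and> f = (\<sigma> u = \<sigma> v) \<or>
              R' = R \<and> B' = insert {u, v} B \<and> f = (\<sigma> u \<noteq> \<sigma> v)"
    and C': "C' = (\<lambda>w. if C w = C v then C u else C w)"
    and \<sigma>': "\<sigma>' = (\<lambda>w. if C w = C v then \<sigma> w \<noteq> f else \<sigma> w)"
    and safe: "safe (score R' B' (cls C' \<sigma>' (C u) (\<sigma> u)) (cls C' \<sigma>' (C u) (\<not> \<sigma> u)))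
                    (score R' B' (cls C' \<sigma>' (C u) (\<not> \<sigma> u)) (cls C' \<sigma>' (C u) (\<sigma> u)))"
  shows "painter_inv R' B' C' \<sigma>'"
proof -
  note I = painter_invD[OF inv]
  have R': "finite R'" "finite B'" "{} \<notin> R'" "{} \<notin> B'" "R \<subseteq> R'" "B \<subseteq> B'"
    using ext I by auto
  have red: "C' x = C' y \<and> \<sigma>' x \<noteq> \<sigma>' y" if "{x, y} \<in> R'" for x y
    using that ext uv I(5)[of x y] by (auto simp: C' \<sigma>' doubleton_eq_iff)
  have blue: "C' x = C' y \<and> \<sigma>' x = \<sigma>' y" if "{x, y} \<in> B'" for x y
    using that ext uv I(6)[of x y] by (auto simp: C' \<sigma>' doubleton_eq_iff)
  have "cls C' \<sigma>' c \<tau> \<subseteq> (cls C \<sigma> c True \<union> cls C \<sigma> c False) \<union> (cls C \<sigma> (C v) True \<union> cls C \<sigma> (C v) False)"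
    for c \<tau>
    by (auto simp: cls_def C')
  then have fin: "finite (cls C' \<sigma>' c \<tau>)" for c \<tau>
    by (rule finite_subset) (intro finite_UnI I(7))
  have "fine (score R' B' (cls C' \<sigma>' (C' w) (\<sigma>' w)) (cls C' \<sigma>' (C' w) (\<not> \<sigma>' w)))
             (score R' B' (cls C' \<sigma>' (C' w) (\<not> \<sigma>' w)) (cls C' \<sigma>' (C' w) (\<sigma>' w)))" for w
  proof (cases "C' w = C u")
    case True
    have "\<sigma>' w = \<sigma> u \<or> \<sigma>' w = (\<not> \<sigma> u)" by auto
    then show ?thesis
      using safe unfolding True fine_def by (auto simp: safe_commute)
  next
    case False
    then have w: "C' w = C w" "\<sigma>' w = \<sigma> w" "C w \<noteq> C u" "C w \<noteq> C v"
      by (auto simp: C' \<sigma>' split: if_splits)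
    then have "cls C' \<sigma>' (C' w) \<tau> = cls C \<sigma> (C w) \<tau>" for \<tau>
      by (auto simp: cls_def C' \<sigma>')
    then show ?thesis
      using w(2) by (auto intro!: fine_mono[OF I(8)[of w]] score_mono R')
  qed
  with R' red blue fin show ?thesis
    unfolding painter_inv_def by blast
qed

lemma painter_inv_step:
  assumes inv: "painter_inv R B C \<sigma>" and "u \<noteq> v" "{u, v} \<notin> R" "{u, v} \<notin> B"
  shows "\<exists>C \<sigma>. painter_inv (insert {u, v} R) B C \<sigma> \<or> painter_inv R (insert {u, v} B) C \<sigma>"
proof (cases "C u = C v")
  case True
  then show ?thesis
    using painter_inv_insert[OF inv] by blast
next
  case False
  note I = painter_invD[OF inv]
  define S T P Q where S: "S = cls C \<sigma> (C u) (\<sigma> u)" and T: "T = cls C \<sigma> (C u) (\<not> \<sigma> u)"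
    and P: "P = cls C \<sigma> (C v) (\<sigma> v)" and Q: "Q = cls C \<sigma> (C v) (\<not> \<sigma> v)"
  note STPQ = S T P Q
  define C' where "C' = (\<lambda>w. if C w = C v then C u else C w)"
  define \<sigma>r where "\<sigma>r = (\<lambda>w. if C w = C v then \<sigma> w \<noteq> (\<sigma> u = \<sigma> v) else \<sigma> w)"
  define \<sigma>b where "\<sigma>b = (\<lambda>w. if C w = C v then \<sigma> w \<noteq> (\<sigma> u \<noteq> \<sigma> v) else \<sigma> w)"
  have r: "cls C' \<sigma>r (C u) (\<sigma> u) = S \<union> Q" "cls C' \<sigma>r (C u) (\<not> \<sigma> u) = T \<union> P"
    using False by (auto simp: cls_def C'_def \<sigma>r_def STPQ split: if_splits)
  have b: "cls C' \<sigma>b (C u) (\<sigma> u) = S \<union> P" "cls C' \<sigma>b (C u) (\<not> \<sigma> u) = T \<union> Q"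
    using False by (auto simp: cls_def C'_def \<sigma>b_def STPQ split: if_splits)
  have disj: "(S \<union> T) \<inter> (P \<union> Q) = {}" and mem: "u \<in> S" "v \<in> P"
    using False by (auto simp: cls_def STPQ)
  let ?R = "insert {u, v} R" and ?B = "insert {u, v} B"
  have red_plus: "score ?R B X Y = score R B X Y + 1" if "{u, v} \<subseteq> X \<union> Y" for X Y
    using inside_insert[OF I(1) assms(3) that] by (simp add: score_def)
  \<comment> \<open>A red edge across the sides raises both scores, but a blue edge only that of the
    side opposite to it; hence the 1 in place of 2 in one entry of the blue option.\<close>
  have blue_plus: "score R ?B X Y = score R B X Y + 1" if "{u, v} \<subseteq> Y" for X Y
    using inside_insert[OF I(2) assms(4) that] by (simp add: score_def)
  let ?\<alpha> = "score R B S T" and ?\<beta> = "score R B T S" and ?\<gamma> = "score R B P Q" and ?\<delta> = "score R B Q P"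
  have "fine ?\<alpha> ?\<beta>" "fine ?\<gamma> ?\<delta>"
    using I(8)[of u] I(8)[of v] by (simp_all add: STPQ)
  then consider "safe (?\<alpha> + ?\<delta> + 2 - 2 * \<phi>) (?\<beta> + ?\<gamma> + 2 - 2 * \<phi>)"
    | "safe (?\<alpha> + ?\<gamma> + 1 - 2 * \<phi>) (?\<beta> + ?\<delta> + 2 - 2 * \<phi>)"
    using painter_option by blast
  then show ?thesis
  proof cases
    case 1
    have "?\<alpha> + ?\<delta> + 1 - 2 * \<phi> \<le> score R B (S \<union> Q) (T \<union> P)"
      "?\<beta> + ?\<gamma> + 1 - 2 * \<phi> \<le> score R B (T \<union> P) (S \<union> Q)"
      using disj by (intro score_Un I; auto)+
    then have "safe (score ?R B (S \<union> Q) (T \<union> P)) (score ?R B (T \<union> P) (S \<union> Q))"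
      using mem by (intro safe_mono[OF 1]) (auto simp: red_plus)
    then have "painter_inv ?R B C' \<sigma>r"
      by (intro painter_inv_merge[OF inv False _ C'_def \<sigma>r_def]) (auto simp: r)
    then show ?thesis by blast
  next
    case 2
    have "?\<alpha> + ?\<gamma> + 1 - 2 * \<phi> \<le> score R B (S \<union> P) (T \<union> Q)"
      "?\<beta> + ?\<delta> + 1 - 2 * \<phi> \<le> score R B (T \<union> Q) (S \<union> P)"
      using disj by (intro score_Un I; auto)+
    moreover have "score R B (S \<union> P) (T \<union> Q) \<le> score R ?B (S \<union> P) (T \<union> Q)"
      using I by (intro score_mono) auto
    ultimately have "safe (score R ?B (S \<union> P) (T \<union> Q)) (score R ?B (T \<union> Q) (S \<union> P))"
      using mem by (intro safe_mono[OF 2]) (auto simp: blue_plus)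
    then have "painter_inv R ?B C' \<sigma>b"
      by (intro painter_inv_merge[OF inv False _ C'_def \<sigma>b_def]) (auto simp: b)
    then show ?thesis by blast
  qed
qed

text \<open>A blue path stays in one side \<open>S\<close>, which thus has at least \<open>n\<close>
  vertices. Its \<open>n - 1\<close> edges come on top of those counted in the nonnegative score of
  \<open>S\<close>.\<close>

lemma painter_inv_over:
  assumes inv: "painter_inv R B C \<sigma>" and "n \<ge> 1" "game_over n R B"
  shows "\<phi> * (real n - 2) + real n \<le> real (card R + card B)"
proof -
  note I = painter_invD[OF inv]
  have "\<not> red_triangle R"
    unfolding red_triangle_def using I(5) by metis
  then obtain vs where vs: "length vs = n" "distinct vs"
    "\<And>i. i + 1 < n \<Longrightarrow> {vs ! i, vs ! (i + 1)} \<in> B"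
    using assms(3) by (auto simp: game_over_def blue_path_def)
  define w where "w = vs ! 0"
  define S T where "S = cls C \<sigma> (C w) (\<sigma> w)" and "T = cls C \<sigma> (C w) (\<not> \<sigma> w)"
  have S: "vs ! i \<in> S" if "i < n" for i
    using that
  proof (induction i)
    case 0
    then show ?case by (simp add: S_def cls_def w_def)
  next
    case (Suc i)
    then show ?case
      using I(6)[OF vs(3)[of i]] by (simp add: S_def cls_def)
  qed
  have "set vs \<subseteq> S"
    using S vs(1) by (auto simp: in_set_conv_nth)
  then have "card (set vs) \<le> card S"
    by (rule card_mono[rotated]) (simp add: S_def I(7))
  then have nS: "n \<le> card S"
    using vs(1,2) by (simp add: distinct_card)
  let ?e = "\<lambda>i. {vs ! i, vs ! (i + 1)}"
  have "inj_on ?e {..<n - 1}"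
    using vs(1,2) by (auto simp: inj_on_def doubleton_eq_iff nth_eq_iff_index_eq)
  then have "n - 1 = card (?e ` {..<n - 1})"
    by (simp add: card_image)
  also have "\<dots> \<le> inside B S"
    unfolding inside_def using vs(3) S I(2) by (intro card_mono) auto
  finally have bS: "n - 1 \<le> inside B S" .
  have "inside B S + inside B T \<le> inside B (S \<union> T)"
    using I by (intro inside_Un) (auto simp: S_def T_def cls_def)
  also have "\<dots> \<le> card B"
    unfolding inside_def using I by (intro card_mono) auto
  finally have B: "inside B S + inside B T \<le> card B" .
  have R: "inside R (S \<union> T) \<le> card R"
    unfolding inside_def using I by (intro card_mono) auto
  have "0 \<le> score R B S T"
    using fine_nonneg[OF I(8)[of w]] by (simp add: S_def T_def)
  moreover have "\<phi> * (real n - 2) \<le> \<phi> * (real (card S) - 2)"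
    using nS by (intro mult_golden_ratio) simp
  ultimately have "\<phi> * (real n - 2) + 1 \<le> real (inside R (S \<union> T)) + real (inside B T)"
    unfolding score_def by linarith
  then show ?thesis
    using R B bS assms(2) by linarith
qed

text \<open>Each round adds one edge and uses up one of the \<open>k\<close> rounds, so the
  right-hand side stays constant while Painter keeps the invariant.\<close>

lemma painter_bound:
  assumes "painter_inv R B C \<sigma>" "n \<ge> 1" "builder_wins n k R B"
  shows "\<phi> * (real n - 2) + real n \<le> real (card R + card B + k)"
  using assms
proof (induction k arbitrary: R B C \<sigma>)
  case 0
  then show ?case
    using painter_inv_over by (auto simp: builder_wins.simps)
next
  case (Suc k)
  show ?case
  proof (cases "game_over n R B")
    case True
    then show ?thesis
      using painter_inv_over[OF Suc.prems(1,2)] by simp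
  next
    case False
    then obtain u v where uv: "u \<noteq> v" "{u, v} \<notin> R" "{u, v} \<notin> B"
      "builder_wins n k (insert {u, v} R) B" "builder_wins n k R (insert {u, v} B)"
      using Suc.prems(3) by (auto simp: builder_wins.simps)
    have fin: "finite R" "finite B"
      using Suc.prems(1) by (auto simp: painter_inv_def)
    obtain C' \<sigma>' where "painter_inv (insert {u, v} R) B C' \<sigma>' \<or> painter_inv R (insert {u, v} B) C' \<sigma>'"
      using painter_inv_step[OF Suc.prems(1) uv(1-3)] by blast
    then show ?thesis
      using Suc.IH[of "insert {u, v} R" B C' \<sigma>'] Suc.IH[of R "insert {u, v} B" C' \<sigma>']
        uv fin Suc.prems(2) by auto
  qed
qed

theorem corollary1:
  fixes n :: nat
  assumes "n \<ge> 3"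
  shows "\<lceil>(golden_ratio + 1) * real n - 2 * golden_ratio\<rceil> \<le> int (online_ramsey_C3_P n)
         \<and> online_ramsey_C3_P n \<le> 3 * n - 4"
proof
  have win: "builder_wins n (3 * n - 4) {} {}"
    using assms by (rule builder_wins_start)
  show "online_ramsey_C3_P n \<le> 3 * n - 4"
    unfolding online_ramsey_C3_P_def using win by (rule Least_le)
  \<comment> \<open>The upper bound also shows that the \<open>LEAST\<close> is attained.\<close>
  have "builder_wins n (online_ramsey_C3_P n) {} {}"
    unfolding online_ramsey_C3_P_def using win by (rule LeastI)
  then have "\<phi> * (real n - 2) + real n \<le> real (online_ramsey_C3_P n)"
    using painter_bound[OF painter_inv_start] assms by fastforce
  then show "\<lceil>(golden_ratio + 1) * real n - 2 * golden_ratio\<rceil> \<le> int (online_ramsey_C3_P n)"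
    by (simp add: ceiling_le_iff algebra_simps)
qed

end
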